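(* Let $\mathcal{X}\subseteq\mathbb{R}^n$ be a convex domain and let $\Phi:\mathcal{X}\to\mathbb{R}$ be a Bregman generator of the form $\Phi(\mathbf{x})=\phi(g(\mathbf{x}))$, where $g:\mathcal{X}\to\mathbb{R}$ and $\phi:\mathbb{R}\to\mathbb{R}$ are Bregman generators and $\phi$ is non-decreasing. Then, for any law-invariant risk functional $\rho$, any random vector $\mathbf{X}$, and any $\epsilon\ge0$, $$\sup_{\mathbf{Z}\in\mathfrak{B}^n_{\Phi,\epsilon}(\mathbf{X})}\rho(g(\mathbf{Z}))\le\sup_{Z\in\mathfrak{B}_{\phi,\epsilon}(g(\mathbf{X}))}\rho(Z).$$
   Context: All random variables/vectors live on a fixed non-atomic probability space $(\Omega,\mathcal{B},\mathbb{P})$ with $\mathcal{B}=\mathcal{B}(\mathbb{R}^n)$; random vectors take values in $\mathcal{X}$. A Bregman generator is a convex (not necessarily strictly) differentiable function on a convex domain; its Bregman divergence is $B_\Phi(\mathbf{z}_1,\mathbf{z}_2)=\Phi(\mathbf{z}_1)-\Phi(\mathbf{z}_2)-\nabla\Phi(\mathbf{z}_2)\cdot(\mathbf{z}_1-\mathbf{z}_2)$. The Bregman-Wasserstein (BW) divergence from cdf $F$ to cdf $G$ is $\mathcal{B}^n_\Phi[F,G]=\inf\mathbb{E}[B_\Phi(\mathbf{X},\mathbf{Y})]$ over all couplings with $F_{\mathbf{X}}=F$, $F_{\mathbf{Y}}=G$. The BW uncertainty set is $\mathfrak{B}^n_{\Phi,\epsilon}(\mathbf{X})=\{\mathbf{Z}:\mathcal{B}^n_\Phi[F_{\mathbf{Z}},F_{\mathbf{X}}]\le\epsilon\}$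 (superscript dropped for $n=1$); it is tacitly assumed that such sets contain at least two elements. A risk functional $\rho$ is a real-valued functional on random variables (on $\mathcal{L}^p$, the random variables with finite $p$-th absolute moment for a suitable $p\ge1$, quantities involved assumed well defined); it is law invariant if $\rho(X)=\rho(Y)$ whenever $X,Y$ have the same distribution. Standing assumption: $g$ is non-constant. *)

theory Defs
  imports "HOL-Probability.Probability"
begin

text \<open>
  The domain \<open>S\<close> need not be open, so differentiability is meant within \<open>S\<close>.
\<close>

definition bregman_generator :: "'a::euclidean_space set \<Rightarrow> ('a \<Rightarrow> real) \<Rightarrow> bool" where
  "bregman_generator S \<Phi> \<longleftrightarrow> convex S \<and> convex_on S \<Phi> \<and> \<Phi> differentiable_on S"

text \<open>
  If \<open>S\<close> has empty interior the gradient is not unique, but its inner product with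
  \<open>z - x\<close> for \<open>x, z \<in> S\<close> is the one-sided directional derivative of \<open>\<Phi>\<close> at \<open>x\<close> towards \<open>z\<close>.
  So on \<open>S\<close> the Bregman divergence below does not depend on the choice of gradient.
\<close>

definition gradient_on :: "'a::euclidean_space set \<Rightarrow> ('a \<Rightarrow> real) \<Rightarrow> 'a \<Rightarrow> 'a" where
  "gradient_on S \<Phi> x = (SOME v. (\<Phi> has_derivative (\<lambda>h. v \<bullet> h)) (at x within S))"

definition bregman_div :: "'a::euclidean_space set \<Rightarrow> ('a \<Rightarrow> real) \<Rightarrow> 'a \<Rightarrow> 'a \<Rightarrow> real" where
  "bregman_div S \<Phi> z1 z2 = \<Phi> z1 - \<Phi> z2 - gradient_on S \<Phi> z2 \<bullet> (z1 - z2)"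

definition nonatomic :: "'w measure \<Rightarrow> bool" where
  "nonatomic M \<longleftrightarrow> (\<forall>A\<in>sets M. 0 < emeasure M A \<longrightarrow>
     (\<exists>B\<in>sets M. B \<subseteq> A \<and> 0 < emeasure M B \<and> emeasure M B < emeasure M A))"

definition random_vectors ::
    "'w measure \<Rightarrow> 'a::euclidean_space set \<Rightarrow> ('w \<Rightarrow> 'a) set" where
  "random_vectors M S = {X \<in> borel_measurable M. \<forall>\<omega>\<in>space M. X \<omega> \<in> S}"

text \<open>
  The order on \<^typ>\<open>real ^ 'n\<close> is the componentwise one, so this is the joint cdf.
\<close>

definition joint_cdf ::
    "'w measure \<Rightarrow> ('w \<Rightarrow> 'a::ordered_euclidean_space) \<Rightarrow> 'a \<Rightarrow> real" where
  "joint_cdf M X = (\<lambda>x. measure M {\<omega> \<in> space M. X \<omega> \<le> x})"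

definition couplings ::
    "'w measure \<Rightarrow> 'a::ordered_euclidean_space set \<Rightarrow> ('a \<Rightarrow> real) \<Rightarrow> ('a \<Rightarrow> real) \<Rightarrow>
     (('w \<Rightarrow> 'a) \<times> ('w \<Rightarrow> 'a)) set" where
  "couplings M S F G = {(X, Y). X \<in> random_vectors M S \<and> Y \<in> random_vectors M S \<and>
     joint_cdf M X = F \<and> joint_cdf M Y = G}"

text \<open>
  A Bregman divergence is nonnegative on \<open>S\<close>, hence its expectation always exists in
  \<open>[0, \<infinity>]\<close> and \<^const>\<open>ennreal\<close> truncates nothing.
\<close>

definition bw_div ::
    "'w measure \<Rightarrow> 'a::ordered_euclidean_space set \<Rightarrow> ('a \<Rightarrow> real) \<Rightarrow>
     ('a \<Rightarrow> real) \<Rightarrow> ('a \<Rightarrow> real) \<Rightarrow> ennreal" where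
  "bw_div M S \<Phi> F G =
     (INF (X, Y) \<in> couplings M S F G. \<integral>\<^sup>+\<omega>. ennreal (bregman_div S \<Phi> (X \<omega>) (Y \<omega>)) \<partial>M)"

definition bw_set ::
    "'w measure \<Rightarrow> 'a::ordered_euclidean_space set \<Rightarrow> ('a \<Rightarrow> real) \<Rightarrow> real \<Rightarrow>
     ('w \<Rightarrow> 'a) \<Rightarrow> ('w \<Rightarrow> 'a) set" where
  "bw_set M S \<Phi> \<epsilon> X =
     {Z \<in> random_vectors M S. bw_div M S \<Phi> (joint_cdf M Z) (joint_cdf M X) \<le> ennreal \<epsilon>}"

definition L_space :: "real \<Rightarrow> 'w measure \<Rightarrow> ('w \<Rightarrow> real) set" where
  "L_space p M = {X \<in> borel_measurable M. integrable M (\<lambda>\<omega>. \<bar>X \<omega>\<bar> powr p)}"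

text \<open>
  A risk functional on \<^term>\<open>L_space p M\<close> is a total function here; only its values on
  \<^term>\<open>L_space p M\<close> are meaningful.
\<close>

definition law_invariant :: "real \<Rightarrow> 'w measure \<Rightarrow> (('w \<Rightarrow> real) \<Rightarrow> real) \<Rightarrow> bool" where
  "law_invariant p M \<rho> \<longleftrightarrow> (\<forall>X\<in>L_space p M. \<forall>Y\<in>L_space p M.
     distr M borel X = distr M borel Y \<longrightarrow> \<rho> X = \<rho> Y)"

end

theory Submission
  imports Defs
begin

text \<open>
  The map \<open>g\<close> does not increase the divergence: comparing \<open>\<Phi> = \<phi> \<circ> g\<close> along a segment from \<open>y\<close> to
  \<open>x\<close> with \<open>\<phi>\<close> along the chord of \<open>g\<close>, convexity of \<open>g\<close> and monotonicity of \<open>\<phi>\<close> give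
  \<open>\<nabla>\<Phi> y \<bullet> (x - y) \<le> \<phi>' (g y) (g x - g y)\<close>. Since a joint cdf determines the law, \<open>g\<close> also pushes
  couplings forward to couplings, so \<open>Z \<mapsto> g \<circ> Z\<close> maps the uncertainty set of \<open>X\<close> into that of
  \<open>g \<circ> X\<close>.
\<close>

text \<open>The choice made by \<open>gradient_on\<close> is not vacuous: any derivative
  \<open>D\<close> within \<open>S\<close> is linear and real-valued, hence is the inner product
  with a fixed vector. That Riesz vector is \<open>adjoint D 1\<close>.\<close>

lemma has_derivative_gradient_on:
  assumes "f differentiable_on S" "x \<in> S"
  shows "(f has_derivative (\<lambda>h. gradient_on S f x \<bullet> h)) (at x within S)"
proof -
  obtain D where D: "(f has_derivative D) (at x within S)"
    using assms by (auto simp: differentiable_on_def differentiable_def)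
  then have lin: "linear D"
    by (rule has_derivative_linear)
  have "D = (\<lambda>h. adjoint D 1 \<bullet> h)"
    using adjoint_works[OF lin, of _ 1] by (auto simp: inner_commute)
  with D have "(f has_derivative (\<lambda>h. adjoint D 1 \<bullet> h)) (at x within S)"
    by simp
  then show ?thesis
    unfolding gradient_on_def by (rule someI)
qed

text \<open>Chain rule along the segment from \<open>y\<close> to \<open>x\<close>. The parameter is
  confined to \<open>{0..1}\<close> since only there does convexity keep the segment inside
  \<open>S\<close>, so the derivative at 0 is one-sided.\<close>

lemma has_derivative_segment:
  fixes f :: "'a::real_inner \<Rightarrow> real"
  assumes "(f has_derivative (\<lambda>h. v \<bullet> h)) (at y within S)" "convex S" "x \<in> S" "y \<in> S"
  shows "((\<lambda>t. f (y + t *\<^sub>R (x - y))) has_real_derivative v \<bullet> (x - y)) (at 0 within {0..1})"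
proof -
  let ?\<gamma> = "\<lambda>t. y + t *\<^sub>R (x - y)"
  have "?\<gamma> t \<in> S" if "t \<in> {0..1}" for t
    using convexD_alt[OF assms(2,4,3), of t] that by (simp add: algebra_simps)
  then have "(f has_derivative (\<lambda>h. v \<bullet> h)) (at (?\<gamma> 0) within ?\<gamma> ` {0..1})"
    using assms(1) by (auto intro: has_derivative_subset[where s = S])
  moreover have "(?\<gamma> has_derivative (\<lambda>t. t *\<^sub>R (x - y))) (at 0 within {0..1})"
    by (auto intro!: derivative_eq_intros)
  ultimately have "((\<lambda>t. f (?\<gamma> t)) has_derivative (\<lambda>t. v \<bullet> (t *\<^sub>R (x - y)))) (at 0 within {0..1})"
    by (rule has_derivative_in_compose[rotated])
  then show ?thesis
    by (simp add: has_field_derivative_def mult.commute[of _ "v \<bullet> (x - y)"])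
qed

text \<open>With equal values at 0, the difference quotients for \<open>t > 0\<close> are ordered as
  the functions are, and the order survives in the limit.\<close>

lemma has_real_derivative_mono_at_0:
  fixes f h :: "real \<Rightarrow> real"
  assumes "(f has_real_derivative a) (at 0 within {0..1})"
    and "(h has_real_derivative b) (at 0 within {0..1})"
    and "f 0 = h 0" and "\<And>t. t \<in> {0..1} \<Longrightarrow> f t \<le> h t"
  shows "a \<le> b"
proof (rule tendsto_le)
  show "((\<lambda>t. (f t - f 0) / (t - 0)) \<longlongrightarrow> a) (at 0 within {0..1})"
    and "((\<lambda>t. (h t - h 0) / (t - 0)) \<longlongrightarrow> b) (at 0 within {0..1})"
    using assms(1,2) by (simp_all add: has_field_derivative_iff)
  show "at (0::real) within {0..1} \<noteq> bot"
    by (simp add: at_within_Icc_at_right)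
  show "\<forall>\<^sub>F t in at 0 within {0..1}. (f t - f 0) / (t - 0) \<le> (h t - h 0) / (t - 0)"
    using assms(3,4) by (auto simp: eventually_at_filter intro!: always_eventually divide_right_mono)
qed

lemma bregman_div_compose_le:
  assumes \<Phi>: "bregman_generator S \<Phi>" and g: "convex_on S g"
    and \<phi>: "bregman_generator UNIV \<phi>" and mono: "mono \<phi>"
    and eq: "\<And>x. x \<in> S \<Longrightarrow> \<Phi> x = \<phi> (g x)" and xy: "x \<in> S" "y \<in> S"
  shows "bregman_div UNIV \<phi> (g x) (g y) \<le> bregman_div S \<Phi> x y"
proof -
  have S: "convex S"
    using \<Phi> by (simp add: bregman_generator_def)
  \<comment> \<open>As \<open>\<Phi>\<close> and \<open>\<phi> \<circ> g\<close> agree at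
    \<open>x\<close> and \<open>y\<close>, the two divergences differ only in their gradient terms.
    Each side here is the right derivative at \<open>t = 0\<close> of a function of
    \<open>t\<close>, and both functions start at \<open>\<phi> (g y)\<close>.\<close>
  have "gradient_on S \<Phi> y \<bullet> (x - y) \<le> gradient_on UNIV \<phi> (g y) \<bullet> (g x - g y)"
  proof (rule has_real_derivative_mono_at_0)
    show "((\<lambda>t. \<Phi> (y + t *\<^sub>R (x - y))) has_real_derivative gradient_on S \<Phi> y \<bullet> (x - y))
        (at 0 within {0..1})"
      using \<Phi> S xy
      by (intro has_derivative_segment[where S = S] has_derivative_gradient_on)
        (auto simp: bregman_generator_def)
    show "((\<lambda>t. \<phi> (g y + t *\<^sub>R (g x - g y))) has_real_derivative
        gradient_on UNIV \<phi> (g y) \<bullet> (g x - g y)) (at 0 within {0..1})"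
      using \<phi> by (intro has_derivative_segment[where S = UNIV] has_derivative_gradient_on)
        (auto simp: bregman_generator_def)
    show "\<Phi> (y + 0 *\<^sub>R (x - y)) = \<phi> (g y + 0 *\<^sub>R (g x - g y))"
      using eq xy by simp
    fix t :: real assume t: "t \<in> {0..1}"
    have \<gamma>: "y + t *\<^sub>R (x - y) = (1 - t) *\<^sub>R y + t *\<^sub>R x"
      by (simp add: algebra_simps)
    have "(1 - t) *\<^sub>R y + t *\<^sub>R x \<in> S"
      using convexD_alt[OF S xy(2,1)] t by simp
    moreover have "g ((1 - t) *\<^sub>R y + t *\<^sub>R x) \<le> g y + t *\<^sub>R (g x - g y)"
      using convex_onD[OF g _ _ xy(2,1), of t] t by (simp add: algebra_simps)
    ultimately show "\<Phi> (y + t *\<^sub>R (x - y)) \<le> \<phi> (g y + t *\<^sub>R (g x - g y))"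
      unfolding \<gamma> using eq mono by (simp add: monoD)
  qed
  then show ?thesis
    using eq xy by (simp add: bregman_div_def)
qed

text \<open>The lower orthants \<open>{..a}\<close> form a pi-system generating the Borel sets, and
  a joint cdf records the measure of each of them. Uniqueness of finite measures on a pi-system does
  the rest.\<close>

lemma distr_eq_of_joint_cdf_eq:
  fixes X Y :: "'w \<Rightarrow> 'a::ordered_euclidean_space"
  assumes "finite_measure M" and X: "X \<in> borel_measurable M" and Y: "Y \<in> borel_measurable M"
    and cdf: "joint_cdf M X = joint_cdf M Y"
  shows "distr M borel X = distr M borel Y"
proof -
  interpret finite_measure M by fact
  let ?E = "range atMost :: 'a set set"
  have borel: "sets (borel :: 'a measure) = sigma_sets UNIV ?E"
    by (simp add: borel_eq_atMost)
  show ?thesis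
  proof (rule measure_eqI_generator_eq)
    show "Int_stable ?E"
    proof -
      have "{..a} \<inter> {..b} = {..inf a b}" for a b :: 'a
        by auto
      then show ?thesis
        unfolding Int_stable_def by (metis (no_types, lifting) image_iff rangeI)
    qed
    show "?E \<subseteq> Pow UNIV" by simp
    show "range (\<lambda>n::nat. {.. real n *\<^sub>R One :: 'a}) \<subseteq> ?E" by auto
    show "(\<Union>n::nat. {.. real n *\<^sub>R One :: 'a}) = UNIV"
    proof -
      \<comment> \<open>Each orthant contains the open cube centred at 0 with the same upper corner,
        and these cubes already cover the space.\<close>
      have "box (- (real n *\<^sub>R One)) (real n *\<^sub>R One :: 'a) \<subseteq> {.. real n *\<^sub>R One}" for n
        unfolding atMost_def eucl_le[where 'a = 'a] box_def using less_imp_le by blast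
      then have "(\<Union>n::nat. box (- (real n *\<^sub>R One)) (real n *\<^sub>R One :: 'a)) \<subseteq> (\<Union>n::nat. {.. real n *\<^sub>R One})"
        by (intro UN_mono) simp_all
      then show ?thesis
        unfolding UN_box_eq_UNIV by (rule top.extremum_uniqueI)
    qed
    show "emeasure (distr M borel X) A = emeasure (distr M borel Y) A" if "A \<in> ?E" for A
    proof -
      from that obtain a where A: "A = {..a}" by auto
      have "X -` A \<inter> space M = {\<omega> \<in> space M. X \<omega> \<le> a}" "Y -` A \<inter> space M = {\<omega> \<in> space M. Y \<omega> \<le> a}"
        by (auto simp: A)
      moreover have "A \<in> sets borel" by (simp add: A)
      ultimately show ?thesis
        using fun_cong[OF cdf, of a] X Y
        by (simp add: emeasure_distr emeasure_eq_measure joint_cdf_def)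
    qed
    show "sets (distr M borel X) = sigma_sets UNIV ?E" "sets (distr M borel Y) = sigma_sets UNIV ?E"
      by (simp_all only: sets_distr borel)
    interpret X: finite_measure "distr M borel X"
      using X by (rule finite_measure_distr)
    show "emeasure (distr M borel X) {.. real n *\<^sub>R One} \<noteq> \<infinity>" for n
      by (simp add: X.emeasure_eq_measure)
  qed
qed

text \<open>Nothing is known about \<open>g\<close> off \<open>S\<close>, so \<open>X\<close> is
  first regarded as a measurable map into \<open>S\<close> with its trace sigma-algebra.\<close>

lemma compose_random_vectors:
  assumes "continuous_on S g" "X \<in> random_vectors M S"
  shows "(\<lambda>\<omega>. g (X \<omega>)) \<in> random_vectors M UNIV"
proof -
  have "X \<in> measurable M (restrict_space borel S)"
    using assms(2) by (intro measurable_restrict_space2) (auto simp: random_vectors_def)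
  then have "(\<lambda>\<omega>. g (X \<omega>)) \<in> borel_measurable M"
    by (rule measurable_compose[OF _ borel_measurable_continuous_on_restrict[OF assms(1)]])
  then show ?thesis
    by (simp add: random_vectors_def)
qed

text \<open>
  The set \<open>S\<close> need not be Borel, so the law is transported via the trace \<open>\<sigma>\<close>-algebra on \<open>S\<close>.
\<close>

lemma joint_cdf_compose_eq:
  fixes X Y :: "'w \<Rightarrow> 'a::ordered_euclidean_space" and g :: "'a \<Rightarrow> real"
  assumes "finite_measure M" and g: "continuous_on S g"
    and X: "X \<in> random_vectors M S" and Y: "Y \<in> random_vectors M S"
    and cdf: "joint_cdf M X = joint_cdf M Y"
  shows "joint_cdf M (\<lambda>\<omega>. g (X \<omega>)) = joint_cdf M (\<lambda>\<omega>. g (Y \<omega>))"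
proof
  fix c :: real
  have S: "X \<omega> \<in> S" "Y \<omega> \<in> S" if "\<omega> \<in> space M" for \<omega>
    using X Y that by (auto simp: random_vectors_def)
  have "{x \<in> S. g x \<le> c} \<in> sets (restrict_space borel S)"
    using measurable_sets[OF borel_measurable_continuous_on_restrict[OF g], of "{..c}"]
    by (simp add: space_restrict_space vimage_def Int_def conj_commute)
  \<comment> \<open>\<open>B\<close> is Borel in the whole space, so equality of laws applies to it.
    Both vectors stay in \<open>S\<close>, where \<open>B\<close> coincides with the sublevel set of
    \<open>g\<close>.\<close>
  then obtain B where B: "B \<in> sets borel" "{x \<in> S. g x \<le> c} = S \<inter> B"
    by (auto simp: sets_restrict_space)
  have "{\<omega> \<in> space M. g (Z \<omega>) \<le> c} = Z -` B \<inter> space M"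
    if "\<And>\<omega>. \<omega> \<in> space M \<Longrightarrow> Z \<omega> \<in> S" for Z
    using that B(2) by blast
  moreover have "measure M (X -` B \<inter> space M) = measure M (Y -` B \<inter> space M)"
    using distr_eq_of_joint_cdf_eq[OF assms(1) _ _ cdf] B(1) X Y
    by (metis (lifting) measure_distr random_vectors_def mem_Collect_eq)
  ultimately show "joint_cdf M (\<lambda>\<omega>. g (X \<omega>)) c = joint_cdf M (\<lambda>\<omega>. g (Y \<omega>)) c"
    using S by (simp add: joint_cdf_def)
qed

lemma bw_div_compose_le:
  fixes g :: "'a::ordered_euclidean_space \<Rightarrow> real"
  assumes M: "finite_measure M"
    and \<Phi>: "bregman_generator S \<Phi>" and g: "bregman_generator S g"
    and \<phi>: "bregman_generator UNIV \<phi>" "mono \<phi>" and eq: "\<And>x. x \<in> S \<Longrightarrow> \<Phi> x = \<phi> (g x)"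
    and Z: "Z \<in> random_vectors M S" and X: "X \<in> random_vectors M S"
  shows "bw_div M UNIV \<phi> (joint_cdf M (\<lambda>\<omega>. g (Z \<omega>))) (joint_cdf M (\<lambda>\<omega>. g (X \<omega>)))
    \<le> bw_div M S \<Phi> (joint_cdf M Z) (joint_cdf M X)"
proof -
  have g_convex: "convex_on S g" and g_cont: "continuous_on S g"
    using g by (auto simp: bregman_generator_def differentiable_imp_continuous_on)
  show ?thesis
    unfolding bw_div_def
  proof (rule INF_mono, clarify)
    fix U V assume UV: "(U, V) \<in> couplings M S (joint_cdf M Z) (joint_cdf M X)"
    then have rv: "U \<in> random_vectors M S" "V \<in> random_vectors M S"
      by (auto simp: couplings_def)
    \<comment> \<open>\<open>U\<close> and \<open>V\<close> need not be \<open>Z\<close> and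
      \<open>X\<close>; they only share their joint cdfs. Hence the marginals of the image pair are
      identified through \<open>joint_cdf_compose_eq\<close>.\<close>
    have "((\<lambda>\<omega>. g (U \<omega>)), (\<lambda>\<omega>. g (V \<omega>))) \<in>
        couplings M UNIV (joint_cdf M (\<lambda>\<omega>. g (Z \<omega>))) (joint_cdf M (\<lambda>\<omega>. g (X \<omega>)))"
      using UV Z X
      by (auto simp: couplings_def intro: compose_random_vectors[OF g_cont]
          joint_cdf_compose_eq[OF M g_cont])
    moreover have "(\<integral>\<^sup>+\<omega>. bregman_div UNIV \<phi> (g (U \<omega>)) (g (V \<omega>)) \<partial>M)
        \<le> (\<integral>\<^sup>+\<omega>. bregman_div S \<Phi> (U \<omega>) (V \<omega>) \<partial>M)"
      using rv by (intro nn_integral_mono ennreal_leI bregman_div_compose_le[OF \<Phi> g_convex \<phi> eq])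
        (auto simp: random_vectors_def)
    ultimately show "\<exists>p\<in>couplings M UNIV (joint_cdf M (\<lambda>\<omega>. g (Z \<omega>))) (joint_cdf M (\<lambda>\<omega>. g (X \<omega>))).
        (case p of (X, Y) \<Rightarrow> \<integral>\<^sup>+\<omega>. bregman_div UNIV \<phi> (X \<omega>) (Y \<omega>) \<partial>M)
        \<le> (\<integral>\<^sup>+\<omega>. bregman_div S \<Phi> (U \<omega>) (V \<omega>) \<partial>M)"
      by (intro bexI) auto
  qed
qed

text \<open>Suprema in \<open>ereal\<close> allow unbounded risks and an empty index set. Both sides
  range over \<open>L_space p M\<close>, where the values of \<open>\<rho>\<close> are
  meaningful.\<close>

theorem theorem5:
  fixes M :: "(real ^ 'n) measure"
    and S :: "(real ^ 'n) set"
    and \<Phi> g :: "real ^ 'n \<Rightarrow> real"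
    and \<phi> :: "real \<Rightarrow> real"
    and \<rho> :: "(real ^ 'n \<Rightarrow> real) \<Rightarrow> real"
    and X :: "real ^ 'n \<Rightarrow> real ^ 'n"
    and p \<epsilon> :: real
  assumes "prob_space M" and "sets M = sets borel" and "nonatomic M"
    and "convex S"
    and "bregman_generator S \<Phi>"
    and "bregman_generator S g"
    and "bregman_generator UNIV \<phi>"
    and "mono \<phi>"
    and "\<forall>x\<in>S. \<Phi> x = \<phi> (g x)"
    and "\<exists>x\<in>S. \<exists>y\<in>S. g x \<noteq> g y"
    and "p \<ge> 1"
    and "law_invariant p M \<rho>"
    and "X \<in> random_vectors M S"
    and "\<epsilon> \<ge> 0"
    and "\<exists>Z1 \<in> bw_set M S \<Phi> \<epsilon> X. \<exists>Z2 \<in> bw_set M S \<Phi> \<epsilon> X. Z1 \<noteq> Z2"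
    and "\<exists>Z1 \<in> bw_set M UNIV \<phi> \<epsilon> (\<lambda>\<omega>. g (X \<omega>)).
           \<exists>Z2 \<in> bw_set M UNIV \<phi> \<epsilon> (\<lambda>\<omega>. g (X \<omega>)). Z1 \<noteq> Z2"
  shows "(SUP Z \<in> {Z \<in> bw_set M S \<Phi> \<epsilon> X. (\<lambda>\<omega>. g (Z \<omega>)) \<in> L_space p M}.
            ereal (\<rho> (\<lambda>\<omega>. g (Z \<omega>))))
       \<le> (SUP Z \<in> bw_set M UNIV \<phi> \<epsilon> (\<lambda>\<omega>. g (X \<omega>)) \<inter> L_space p M. ereal (\<rho> Z))"
proof (rule SUP_mono)
  interpret prob_space M by fact
  fix Z assume "Z \<in> {Z \<in> bw_set M S \<Phi> \<epsilon> X. (\<lambda>\<omega>. g (Z \<omega>)) \<in> L_space p M}"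
  then have Z: "Z \<in> random_vectors M S"
      "bw_div M S \<Phi> (joint_cdf M Z) (joint_cdf M X) \<le> ennreal \<epsilon>"
    and gZ: "(\<lambda>\<omega>. g (Z \<omega>)) \<in> L_space p M"
    by (auto simp: bw_set_def)
  have "bw_div M UNIV \<phi> (joint_cdf M (\<lambda>\<omega>. g (Z \<omega>))) (joint_cdf M (\<lambda>\<omega>. g (X \<omega>)))
      \<le> bw_div M S \<Phi> (joint_cdf M Z) (joint_cdf M X)"
    using Z(1) assms(9) by (intro bw_div_compose_le[OF finite_measure_axioms assms(5,6,7,8)] assms(13)) auto
  \<comment> \<open>With target domain \<open>UNIV\<close>, being a random vector is just
    measurability, which \<open>gZ\<close> supplies.\<close>
  then have "(\<lambda>\<omega>. g (Z \<omega>)) \<in> bw_set M UNIV \<phi> \<epsilon> (\<lambda>\<omega>. g (X \<omega>))"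
    using Z gZ by (auto simp: bw_set_def random_vectors_def L_space_def)
  \<comment> \<open>The witness is \<open>g \<circ> Z\<close> itself, so the two risks compared are
    equal.\<close>
  with gZ show "\<exists>Y\<in>bw_set M UNIV \<phi> \<epsilon> (\<lambda>\<omega>. g (X \<omega>)) \<inter> L_space p M.
      ereal (\<rho> (\<lambda>\<omega>. g (Z \<omega>))) \<le> ereal (\<rho> Y)"
    by (intro bexI) auto
qed

end
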